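(* Consider the online advertising model with one keyword, one client and one webpage slot described in the context, and let $\varpi$ be a stationary ad assignment algorithm for which the overdraft queue has a steady state. Let $\epsilon>0$. If under $\varpi$ the steady-state revenue per budgeting cycle satisfies $E[A^{\varpi}(k)]\ge b-\epsilon$, then $$\bar Q^{\varpi}\ge\frac{\log(1/\epsilon)}{2(1-\log(\varphi P_+))}-1,$$ where $\bar Q^{\varpi}$ is the steady-state mean $E[Q^{\varpi}(k)]$, $\varphi=\Pr(\text{no query arrives during a budgeting cycle})$, and $P_+=\Pr(\tilde b(k)>0)$, and it is assumed that $\varphi>0$ and $P_+>0$.
   Context: Setting. Time is slotted; a budgeting cycle $k$ consists of $N$ consecutive slots $kN,\dots,kN+N-1$. There is one keyword, one client and one webpage slot. In each slot a query arrives with probability $\nu\in(0,1)$, independently over slots. If the client's ad is displayed in response to a query, it is clicked with probability $c\in[0,1]$ (independently), and each click pays a nonnegative integer bid $r$. An ad assignment algorithm $\varpi$ decides, for each query, whether to display the ad; $A^{\varpi}(k)$ denotes the total payment (revenue) from the client during cycle $k$. The client has average budget $b>0$ per cycle; the realized budget $\tilde b(k)$ is a nonnegative-integer-valued random variable with mean $b$ (in the paper's model, $\tilde b(k)=\lceil b\rceil$ w.p. $b-\lfloor b\rfloor$ and $\lfloor b\rfloor$ otherwise), i.i.d. over $k$. The overdraft queue evolves as $Q^{\varpi}(k+1)=\max\{Q^{\varpi}(k)+A^{\varpi}(k)-\tilde b(k),0\}$. Standing assumption: $N\ge b/(\nu rc)$. *)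

theory Defs
  imports "HOL-Probability.Probability"
begin

text \<open>
  What an ad assignment algorithm sees of a slot: whether a query arrived, whether the ad was
  displayed, and whether it was clicked.
\<close>

type_synonym observation = "bool \<times> bool \<times> bool"

text \<open>
  The decision rule has access to the algorithm's memory at the start of the cycle, its private
  randomisation for the cycle, the overdraft at the start of the cycle, the realised budget of the
  cycle and the observations of the earlier slots of the cycle. The memory may carry information
  from cycle to cycle (it is trivial for an algorithm that reacts to the overdraft only).
  Neither \<open>display\<close> nor \<open>update\<close> has the cycle number as an argument: the algorithm is stationary.
\<close>

record ('s, 'u) algorithm =
  memory_space :: "'s measure"
  seed_law :: "'u measure"
  display :: "'s \<Rightarrow> 'u \<Rightarrow> nat \<Rightarrow> nat \<Rightarrow> observation list \<Rightarrow> bool"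
  update :: "'s \<Rightarrow> 'u \<Rightarrow> nat \<Rightarrow> nat \<Rightarrow> observation list \<Rightarrow> 's"

definition stationary_algorithm :: "('s, 'u) algorithm \<Rightarrow> bool" where
  "stationary_algorithm \<pi> \<longleftrightarrow>
     prob_space (seed_law \<pi>) \<and>
     (\<forall>q \<beta> h. (\<lambda>(s, u). display \<pi> s u q \<beta> h)
        \<in> measurable (memory_space \<pi> \<Otimes>\<^sub>M seed_law \<pi>) (count_space UNIV)) \<and>
     (\<forall>q \<beta> h. (\<lambda>(s, u). update \<pi> s u q \<beta> h)
        \<in> measurable (memory_space \<pi> \<Otimes>\<^sub>M seed_law \<pi>) (memory_space \<pi>))"

text \<open>
  The observations of the first \<open>n\<close> slots of a cycle under the decision rule \<open>d\<close>. Here \<open>cl i\<close> says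
  whether the ad would be clicked if it were displayed in slot \<open>i\<close> of the cycle.
\<close>

primrec cycle_log ::
  "(observation list \<Rightarrow> bool) \<Rightarrow> (nat \<Rightarrow> bool) \<Rightarrow> (nat \<Rightarrow> bool) \<Rightarrow> nat \<Rightarrow> observation list"
where
  "cycle_log d qu cl 0 = []"
| "cycle_log d qu cl (Suc n) =
     (let h = cycle_log d qu cl n; shown = qu n \<and> d h
      in h @ [(qu n, shown, shown \<and> cl n)])"

definition clicks :: "observation list \<Rightarrow> nat" where
  "clicks h = length (filter (\<lambda>(arrived, shown, clicked). clicked) h)"

text \<open>
  The mutually independent sources of randomness; \<open>Initial\<close> is the initial memory and overdraft.
\<close>

datatype source = Initial | Query nat | Click nat | Budget nat | Seed nat

locale ad_system = prob_space M
  for M :: "'w measure" +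
  fixes \<nu> c b :: real and r N :: nat
    and \<pi> :: "('s, 'u) algorithm"
    and query click :: "nat \<Rightarrow> 'w \<Rightarrow> bool"       \<comment> \<open>indexed by slots\<close>
    and budget :: "nat \<Rightarrow> 'w \<Rightarrow> nat"            \<comment> \<open>indexed by cycles, like all that follow\<close>
    and seed :: "nat \<Rightarrow> 'w \<Rightarrow> 'u"
    and memory :: "nat \<Rightarrow> 'w \<Rightarrow> 's"
    and Q A :: "nat \<Rightarrow> 'w \<Rightarrow> nat"
  assumes nu: "0 < \<nu>" "\<nu> < 1"
    and c: "0 \<le> c" "c \<le> 1"
    and b: "0 < b"
    and rate_pos: "0 < \<nu> * real r * c"
      \<comment> \<open>makes the next bound meaningful, as division by zero yields zero\<close>
    and N: "real N \<ge> b / (\<nu> * real r * c)"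
    and algorithm: "stationary_algorithm \<pi>"
    and query_measurable: "\<And>t. query t \<in> measurable M (count_space UNIV)"
    and query_prob: "\<And>t. prob {\<omega> \<in> space M. query t \<omega>} = \<nu>"
    and click_measurable: "\<And>t. click t \<in> measurable M (count_space UNIV)"
    and click_prob: "\<And>t. prob {\<omega> \<in> space M. click t \<omega>} = c"
    and budget_measurable: "\<And>k. budget k \<in> measurable M (count_space UNIV)"
    and budget_law:
      "\<And>k. distr M (count_space UNIV) (budget k) = distr M (count_space UNIV) (budget 0)"
    and budget_integrable: "\<And>k. integrable M (\<lambda>\<omega>. real (budget k \<omega>))"
    and budget_mean: "\<And>k. expectation (\<lambda>\<omega>. real (budget k \<omega>)) = b"
    and seed_measurable: "\<And>k. seed k \<in> measurable M (seed_law \<pi>)"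
    and seed_law: "\<And>k. distr M (seed_law \<pi>) (seed k) = seed_law \<pi>"
    and initial_memory_measurable: "memory 0 \<in> measurable M (memory_space \<pi>)"
    and initial_queue_measurable: "Q 0 \<in> measurable M (count_space UNIV)"
    and independent: "indep_sets (\<lambda>x. sets (case x of
          Initial \<Rightarrow> vimage_algebra (space M) (\<lambda>\<omega>. (memory 0 \<omega>, Q 0 \<omega>))
                       (memory_space \<pi> \<Otimes>\<^sub>M count_space UNIV)
        | Query t \<Rightarrow> vimage_algebra (space M) (query t) (count_space UNIV)
        | Click t \<Rightarrow> vimage_algebra (space M) (click t) (count_space UNIV)
        | Budget k \<Rightarrow> vimage_algebra (space M) (budget k) (count_space UNIV)
        | Seed k \<Rightarrow> vimage_algebra (space M) (seed k) (seed_law \<pi>))) UNIV"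
    and revenue: "\<And>k \<omega>. \<omega> \<in> space M \<Longrightarrow>
      A k \<omega> = r * clicks (cycle_log (display \<pi> (memory k \<omega>) (seed k \<omega>) (Q k \<omega>) (budget k \<omega>))
        (\<lambda>i. query (k * N + i) \<omega>) (\<lambda>i. click (k * N + i) \<omega>) N)"
    and overdraft: "\<And>k \<omega>. \<omega> \<in> space M \<Longrightarrow>
      int (Q (Suc k) \<omega>) = max (int (Q k \<omega>) + int (A k \<omega>) - int (budget k \<omega>)) 0"
    and memory_step: "\<And>k \<omega>. \<omega> \<in> space M \<Longrightarrow>
      memory (Suc k) \<omega> = update \<pi> (memory k \<omega>) (seed k \<omega>) (Q k \<omega>) (budget k \<omega>)
        (cycle_log (display \<pi> (memory k \<omega>) (seed k \<omega>) (Q k \<omega>) (budget k \<omega>))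
          (\<lambda>i. query (k * N + i) \<omega>) (\<lambda>i. click (k * N + i) \<omega>) N)"

text \<open>
  The system runs in steady state. This follows if the joint law of memory and overdraft is an
  invariant law of the Markov chain that they form (of the overdraft alone, if the memory is
  trivial).
\<close>

definition steady_state ::
  "'w measure \<Rightarrow> (nat \<Rightarrow> 'w \<Rightarrow> nat) \<Rightarrow> (nat \<Rightarrow> 'w \<Rightarrow> nat) \<Rightarrow> bool" where
  "steady_state M Q A \<longleftrightarrow>
     (\<forall>k. distr M (count_space UNIV) (Q k) = distr M (count_space UNIV) (Q 0)) \<and>
     (\<forall>k. distr M (count_space UNIV) (A k) = distr M (count_space UNIV) (A 0))"

end

theory Submission imports Defs begin

text \<open>
  Write \<open>p = \<phi> P\<^sub>+\<close>. The overdraft at the start of a cycle depends only on earlier cycles, so it is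
  independent of the queries and of the budget of the cycle. With probability \<open>p\<close> the cycle has no
  query and a positive budget; then a nonempty queue shrinks, and at an empty queue at least one
  unit of budget is lost. In steady state the mean loss is \<open>b - E[A] \<le> \<epsilon>\<close>, so that
  \<open>p * P(Q = 0) \<le> \<epsilon>\<close> and, descending one level per cycle, \<open>p ^ (m + 1) * P(Q \<le> m) \<le> \<epsilon>\<close>. For
  \<open>m = \<lfloor>2 E[Q]\<rfloor>\<close>, Markov's inequality gives \<open>P(Q \<le> m) \<ge> 1/2\<close>; take logarithms.
\<close>

section \<open>Sigma-algebras generated by sets of sources\<close>

context ad_system
begin

text \<open>This names the family inside the locale assumption \<open>independent\<close>, so that
  the assumption carries over by unfolding.\<close>

definition source_algebra :: "source \<Rightarrow> 'w measure" where
  "source_algebra x = (case x of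
      Initial \<Rightarrow> vimage_algebra (space M) (\<lambda>\<omega>. (memory 0 \<omega>, Q 0 \<omega>))
                   (memory_space \<pi> \<Otimes>\<^sub>M count_space UNIV)
    | Query t \<Rightarrow> vimage_algebra (space M) (query t) (count_space UNIV)
    | Click t \<Rightarrow> vimage_algebra (space M) (click t) (count_space UNIV)
    | Budget k \<Rightarrow> vimage_algebra (space M) (budget k) (count_space UNIV)
    | Seed k \<Rightarrow> vimage_algebra (space M) (seed k) (seed_law \<pi>))"

text \<open>Only the space and the sets matter here. Packing them as a measure lets
  \<open>measurable\<close> express that a random variable is determined by the sources in
  \<open>I\<close>.\<close>

definition generated_by :: "source set \<Rightarrow> 'w measure" where
  "generated_by I = sigma (space M) (\<Union>x\<in>I. sets (source_algebra x))"

text \<open>These sources determine memory and overdraft at the start of cycle \<open>k\<close>. The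
  queries and the budget of cycle \<open>k\<close> itself are left out, which is what makes them
  independent of that state.\<close>

definition past :: "nat \<Rightarrow> source set" where
  "past k = {Initial} \<union> Query ` {..<k * N} \<union> Click ` {..<k * N} \<union> Budget ` {..<k} \<union> Seed ` {..<k}"

lemma space_source_algebra [simp]: "space (source_algebra x) = space M"
  by (simp add: source_algebra_def split: source.split)

lemma source_algebra_subset: "(\<Union>x\<in>I. sets (source_algebra x)) \<subseteq> Pow (space M)"
  using sets.sets_into_space by fastforce

lemma space_generated_by [simp]: "space (generated_by I) = space M"
  by (simp add: generated_by_def space_measure_of[OF source_algebra_subset])

lemma sets_generated_by: "sets (generated_by I) = sigma_sets (space M) (\<Union>x\<in>I. sets (source_algebra x))"
  by (simp add: generated_by_def sets_measure_of[OF source_algebra_subset])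

lemma measurable_generated_by_mono:
  assumes "I \<subseteq> J" "f \<in> measurable (generated_by I) L"
  shows "f \<in> measurable (generated_by J) L"
proof -
  have "sets (generated_by I) \<subseteq> sets (generated_by J)"
    unfolding sets_generated_by using assms(1) by (intro sigma_sets_mono') blast
  then show ?thesis
    using assms(2) by (auto simp: measurable_def)
qed

lemma measurable_generated_by_source:
  assumes "x \<in> I" "f \<in> measurable (source_algebra x) L"
  shows "f \<in> measurable (generated_by I) L"
proof -
  have "sets (source_algebra x) \<subseteq> sets (generated_by I)"
    unfolding sets_generated_by using assms(1) by (auto intro: sigma_sets.Basic)
  then show ?thesis
    using assms(2) by (auto simp: measurable_def)
qed

lemma measurable_generated_by_Query:
  "Query t \<in> I \<Longrightarrow> query t \<in> measurable (generated_by I) (count_space UNIV)"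
  by (erule measurable_generated_by_source)
    (unfold source_algebra_def source.case, rule measurable_vimage_algebra1, simp)

lemma measurable_generated_by_Click:
  "Click t \<in> I \<Longrightarrow> click t \<in> measurable (generated_by I) (count_space UNIV)"
  by (erule measurable_generated_by_source)
    (unfold source_algebra_def source.case, rule measurable_vimage_algebra1, simp)

lemma measurable_generated_by_Budget:
  "Budget j \<in> I \<Longrightarrow> budget j \<in> measurable (generated_by I) (count_space UNIV)"
  by (erule measurable_generated_by_source)
    (unfold source_algebra_def source.case, rule measurable_vimage_algebra1, simp)

lemma measurable_generated_by_Seed:
  "Seed j \<in> I \<Longrightarrow> seed j \<in> measurable (generated_by I) (seed_law \<pi>)"
  by (rule measurable_generated_by_source)
    (use measurable_space[OF seed_measurable] in
      \<open>auto simp: source_algebra_def intro!: measurable_vimage_algebra1\<close>)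

lemma measurable_generated_by_Initial:
  assumes "Initial \<in> I"
  shows "memory 0 \<in> measurable (generated_by I) (memory_space \<pi>)"
    and "Q 0 \<in> measurable (generated_by I) (count_space UNIV)"
proof -
  have "(\<lambda>\<omega>. (memory 0 \<omega>, Q 0 \<omega>)) \<in>
      measurable (generated_by I) (memory_space \<pi> \<Otimes>\<^sub>M count_space UNIV)"
    by (rule measurable_generated_by_source[OF assms])
      (use measurable_space[OF initial_memory_measurable] in
        \<open>auto simp: source_algebra_def space_pair_measure intro!: measurable_vimage_algebra1\<close>)
  from measurable_compose[OF this measurable_fst] measurable_compose[OF this measurable_snd]
  show "memory 0 \<in> measurable (generated_by I) (memory_space \<pi>)"
    and "Q 0 \<in> measurable (generated_by I) (count_space UNIV)"
    by simp_all
qed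

end

section \<open>Measurability and size of the log of a cycle\<close>

lemma measurable_cycle_log:
  assumes d: "\<And>h. (\<lambda>\<omega>. d \<omega> h) \<in> measurable L (count_space UNIV)"
    and qu: "\<And>i. i < n \<Longrightarrow> (\<lambda>\<omega>. qu \<omega> i) \<in> measurable L (count_space UNIV)"
    and cl: "\<And>i. i < n \<Longrightarrow> (\<lambda>\<omega>. cl \<omega> i) \<in> measurable L (count_space UNIV)"
  shows "(\<lambda>\<omega>. cycle_log (d \<omega>) (qu \<omega>) (cl \<omega>) n) \<in> measurable L (count_space UNIV)"
  using qu cl
proof (induction n)
  case 0
  then show ?case by simp
next
  case (Suc n)
  have IH: "(\<lambda>\<omega>. cycle_log (d \<omega>) (qu \<omega>) (cl \<omega>) n) \<in> measurable L (count_space UNIV)"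
    using Suc by simp
  have q: "(\<lambda>\<omega>. qu \<omega> n) \<in> measurable L (count_space UNIV)"
    and c: "(\<lambda>\<omega>. cl \<omega> n) \<in> measurable L (count_space UNIV)"
    using Suc.prems by simp_all
  \<comment> \<open>All four parameters range over countable types, so each can be frozen and then
    replaced by a random value. The history \<open>h\<close> comes last because \<open>d\<close> is
    known to be measurable only at a fixed history.\<close>
  have "(\<lambda>\<omega>. h @ [(a, a \<and> g, (a \<and> g) \<and> e)]) \<in> measurable L (count_space UNIV)" for h a g e
    by simp
  from measurable_compose_countable[OF this c]
  have "(\<lambda>\<omega>. h @ [(a, a \<and> g, (a \<and> g) \<and> cl \<omega> n)]) \<in> measurable L (count_space UNIV)" for h a g .
  from measurable_compose_countable[OF this d]
  have "(\<lambda>\<omega>. h @ [(a, a \<and> d \<omega> h, (a \<and> d \<omega> h) \<and> cl \<omega> n)]) \<in> measurable L (count_space UNIV)" for h a .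
  from measurable_compose_countable[OF this q]
  have "(\<lambda>\<omega>. h @ [(qu \<omega> n, qu \<omega> n \<and> d \<omega> h, (qu \<omega> n \<and> d \<omega> h) \<and> cl \<omega> n)])
      \<in> measurable L (count_space UNIV)" for h .
  from measurable_compose_countable[OF this IH]
  show ?case by (simp only: cycle_log.simps Let_def)
qed

lemma length_cycle_log [simp]: "length (cycle_log d qu cl n) = n"
  by (induction n) (simp_all add: Let_def)

lemma clicks_le_length: "clicks h \<le> length h"
  by (simp add: clicks_def)

lemma clicks_cycle_log_no_query:
  "(\<And>i. i < n \<Longrightarrow> \<not> qu i) \<Longrightarrow> clicks (cycle_log d qu cl n) = 0"
  by (induction n) (simp_all add: clicks_def Let_def)

section \<open>Queue, memory and revenue as functions of the past sources\<close>

context ad_system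
begin

abbreviation log_of_cycle :: "nat \<Rightarrow> 'w \<Rightarrow> observation list" where
  "log_of_cycle k \<omega> \<equiv> cycle_log (display \<pi> (memory k \<omega>) (seed k \<omega>) (Q k \<omega>) (budget k \<omega>))
     (\<lambda>i. query (k * N + i) \<omega>) (\<lambda>i. click (k * N + i) \<omega>) N"

lemma past_Suc: "past k \<subseteq> past (Suc k)"
  unfolding past_def by (intro Un_mono image_mono order.refl) auto

text \<open>The induction step for the state. Overdraft, budget and log take countably many values,
  so \<open>display\<close> and \<open>update\<close>, measurable in memory and seed for fixed
  discrete arguments, stay measurable when these arguments are random.\<close>

lemma cycle_measurable_past:
  assumes "memory k \<in> measurable (generated_by (past k)) (memory_space \<pi>)"
    and "Q k \<in> measurable (generated_by (past k)) (count_space UNIV)"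
  shows "log_of_cycle k \<in> measurable (generated_by (past (Suc k))) (count_space UNIV)"
    and "memory (Suc k) \<in> measurable (generated_by (past (Suc k))) (memory_space \<pi>)"
    and "Q (Suc k) \<in> measurable (generated_by (past (Suc k))) (count_space UNIV)"
proof -
  let ?L = "generated_by (past (Suc k))"
  have mem: "memory k \<in> measurable ?L (memory_space \<pi>)"
    and que: "Q k \<in> measurable ?L (count_space UNIV)"
    using assms measurable_generated_by_mono[OF past_Suc] by blast+
  have bud: "budget k \<in> measurable ?L (count_space UNIV)"
    by (rule measurable_generated_by_Budget) (simp add: past_def)
  have "seed k \<in> measurable ?L (seed_law \<pi>)"
    by (rule measurable_generated_by_Seed) (simp add: past_def)
  with mem have pair: "(\<lambda>\<omega>. (memory k \<omega>, seed k \<omega>)) \<in> measurable ?L (memory_space \<pi> \<Otimes>\<^sub>M seed_law \<pi>)"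
    by (rule measurable_Pair)
  have dis: "(\<lambda>\<omega>. display \<pi> (memory k \<omega>) (seed k \<omega>) q \<beta> h) \<in> measurable ?L (count_space UNIV)" for q \<beta> h
    using measurable_compose[OF pair, of "\<lambda>(s, u). display \<pi> s u q \<beta> h"] algorithm
    by (simp add: stationary_algorithm_def)
  have upd: "(\<lambda>\<omega>. update \<pi> (memory k \<omega>) (seed k \<omega>) q \<beta> h) \<in> measurable ?L (memory_space \<pi>)" for q \<beta> h
    using measurable_compose[OF pair, of "\<lambda>(s, u). update \<pi> s u q \<beta> h"] algorithm
    by (simp add: stationary_algorithm_def)
  have "(\<lambda>\<omega>. display \<pi> (memory k \<omega>) (seed k \<omega>) (Q k \<omega>) (budget k \<omega>) h)
      \<in> measurable ?L (count_space UNIV)" for h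
    by (rule measurable_compose_countable[OF measurable_compose_countable[OF dis que] bud])
  then show log: "log_of_cycle k \<in> measurable ?L (count_space UNIV)"
    by (rule measurable_cycle_log)
      (auto simp: past_def intro!: measurable_generated_by_Query measurable_generated_by_Click)
  have "(\<lambda>\<omega>. update \<pi> (memory k \<omega>) (seed k \<omega>) (Q k \<omega>) (budget k \<omega>) (log_of_cycle k \<omega>))
      \<in> measurable ?L (memory_space \<pi>)"
    by (rule measurable_compose_countable[OF measurable_compose_countable[OF
            measurable_compose_countable[OF upd que] bud] log])
  then show "memory (Suc k) \<in> measurable ?L (memory_space \<pi>)"
    by (subst measurable_cong[OF memory_step]) simp_all
  \<comment> \<open>Truncated subtraction on the naturals plays the part of the maximum with 0 in
    the recursion.\<close>
  have "(\<lambda>\<omega>. Q k \<omega> + r * clicks (log_of_cycle k \<omega>) - budget k \<omega>) \<in> measurable ?L (count_space UNIV)"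
    using que bud log by measurable
  moreover have "Q (Suc k) \<omega> = Q k \<omega> + r * clicks (log_of_cycle k \<omega>) - budget k \<omega>"
    if "\<omega> \<in> space M" for \<omega>
    using overdraft[OF that, of k] revenue[OF that, of k] by linarith
  ultimately show "Q (Suc k) \<in> measurable ?L (count_space UNIV)"
    by (subst measurable_cong) simp_all
qed

text \<open>Memory and overdraft go through one induction because the step of each reads the
  other.\<close>

lemma state_measurable_past:
  "memory k \<in> measurable (generated_by (past k)) (memory_space \<pi>) \<and>
   Q k \<in> measurable (generated_by (past k)) (count_space UNIV)"
proof (induction k)
  case 0
  have "Initial \<in> past 0" by (simp add: past_def)
  then show ?case
    using measurable_generated_by_Initial by blast
next
  case (Suc k)
  then show ?case
    using cycle_measurable_past by blast
qed

lemmas memory_measurable_past = state_measurable_past[THEN conjunct1]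
  and Q_measurable_past = state_measurable_past[THEN conjunct2]

lemma indep_source_algebras: "indep_sets (\<lambda>x. sets (source_algebra x)) UNIV"
  using independent by (simp add: source_algebra_def)

text \<open>Independence of the source algebras includes that their members are events.
  Measurability with respect to the sources thereby yields measurability on
  \<open>M\<close>.\<close>

lemma sets_generated_by_subset: "sets (generated_by I) \<subseteq> events"
  using indep_source_algebras unfolding sets_generated_by
  by (intro sets.sigma_sets_subset) (auto simp: indep_sets_def)

lemma measurable_generated_by_imp:
  "f \<in> measurable (generated_by I) L \<Longrightarrow> f \<in> measurable M L"
  using sets_generated_by_subset[of I] by (auto simp: measurable_def)

lemma Q_measurable [measurable]: "Q k \<in> measurable M (count_space UNIV)"
  by (rule measurable_generated_by_imp[OF Q_measurable_past])

lemma A_measurable [measurable]: "A k \<in> measurable M (count_space UNIV)"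
proof -
  have [measurable]: "log_of_cycle k \<in> measurable M (count_space UNIV)"
    by (rule measurable_generated_by_imp
        [OF cycle_measurable_past(1)[OF memory_measurable_past Q_measurable_past]])
  have "(\<lambda>\<omega>. r * clicks (log_of_cycle k \<omega>)) \<in> measurable M (count_space UNIV)"
    by measurable
  then show ?thesis
    by (subst measurable_cong[OF revenue]) simp_all
qed

declare budget_measurable [measurable] query_measurable [measurable]

text \<open>A cycle has at most one click per slot. Being bounded, the revenue is
  integrable.\<close>

lemma A_le: "\<omega> \<in> space M \<Longrightarrow> A k \<omega> \<le> r * N"
  using clicks_le_length[of "log_of_cycle k \<omega>"] by (simp add: revenue)

lemma A_integrable: "integrable M (\<lambda>\<omega>. real (A k \<omega>))"
  by (rule integrable_const_bound[of _ "real (r * N)"]) (simp_all add: A_le del: of_nat_mult)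

section \<open>Cycles without a query and with positive budget, and their independence of the
  past\<close>

definition no_query :: "nat \<Rightarrow> 'w set" where
  "no_query k = {\<omega> \<in> space M. \<forall>t \<in> {k * N..<k * N + N}. \<not> query t \<omega>}"

definition positive_budget :: "nat \<Rightarrow> 'w set" where
  "positive_budget k = {\<omega> \<in> space M. budget k \<omega> > 0}"

lemma no_query_A:
  assumes "\<omega> \<in> no_query k"
  shows "A k \<omega> = 0"
  using assms by (subst revenue) (auto simp: no_query_def intro!: clicks_cycle_log_no_query)

text \<open>The three events belong to the sigma-algebras of three disjoint sets of sources: the
  past, the queries of the cycle and its budget.\<close>

lemma prob_starved_cycle:
  assumes "F \<in> sets (generated_by (past k))"
  shows "prob (F \<inter> no_query k \<inter> positive_budget k) =
    prob F * (prob (no_query k) * prob (positive_budget k))"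
proof -
  let ?q = "Query ` {k * N..<k * N + N}"
  let ?I = "\<lambda>j. [past k, ?q, {Budget k}] ! j"
  let ?E = "\<lambda>j. [F, no_query k, positive_budget k] ! j"
  have q: "no_query k \<in> sets (generated_by ?q)"
  proof -
    have "query t \<in> measurable (generated_by ?q) (count_space UNIV)" if "t \<in> {k * N..<k * N + N}" for t
      using that by (intro measurable_generated_by_Query) simp
    then have "{\<omega> \<in> space (generated_by ?q). \<forall>t \<in> {k * N..<k * N + N}. \<not> query t \<omega>} \<in> sets (generated_by ?q)"
      by (intro sets.sets_Collect_finite_All sets.sets_Collect_neg predE) simp_all
    then show ?thesis by (simp add: no_query_def)
  qed
  have p: "positive_budget k \<in> sets (generated_by {Budget k})"
  proof -
    have [measurable]: "budget k \<in> measurable (generated_by {Budget k}) (count_space UNIV)"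
      by (intro measurable_generated_by_Budget) simp
    have "{\<omega> \<in> space (generated_by {Budget k}). budget k \<omega> > 0} \<in> sets (generated_by {Budget k})"
      by measurable
    then show ?thesis by (simp add: positive_budget_def)
  qed
  have three: "{..<3::nat} = {0, 1, 2}" by auto
  \<comment> \<open>Grouping independent families into disjoint blocks keeps independence if the
    families are closed under intersection, as sigma-algebras are.\<close>
  have "indep_sets (\<lambda>j. sigma_sets (space M) (\<Union>x\<in>?I j. sets (source_algebra x))) {..<3}"
  proof (rule indep_sets_collect_sigma)
    show "indep_sets (\<lambda>x. sets (source_algebra x)) (\<Union>j<3. ?I j)"
      by (rule indep_sets_mono_index[OF _ indep_source_algebras]) simp
    show "disjoint_family_on ?I {..<3}"
      unfolding three by (auto simp: disjoint_family_on_def past_def)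
  qed (rule sets.Int_stable)
  then have "indep_sets (\<lambda>j. sets (generated_by (?I j))) {..<3}"
    by (simp add: sets_generated_by)
  then have "prob (\<Inter>j<3. ?E j) = (\<Prod>j<3. prob (?E j))"
    by (rule indep_setsD) (use assms q p in \<open>auto simp: three\<close>)
  then show ?thesis
    by (simp add: three Int_assoc)
qed

lemma Q_le_in_past: "{\<omega> \<in> space M. Q k \<omega> \<le> m} \<in> sets (generated_by (past k))"
proof -
  have [measurable]: "Q k \<in> measurable (generated_by (past k)) (count_space UNIV)"
    by (rule Q_measurable_past)
  have "{\<omega> \<in> space (generated_by (past k)). Q k \<omega> \<le> m} \<in> sets (generated_by (past k))"
    by measurable
  then show ?thesis by simp
qed

section \<open>Consequences of the steady state: invariance of the law of the queue and descent
  through its levels\<close>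

context
  assumes steady: "steady_state M Q A"
begin

lemma steady_Q_distr: "distr M (count_space UNIV) (Q j) = distr M (count_space UNIV) (Q k)"
  using steady by (metis steady_state_def)

lemma steady_Q_le: "prob {\<omega> \<in> space M. Q j \<omega> \<le> m} = prob {\<omega> \<in> space M. Q k \<omega> \<le> m}"
proof -
  have "prob {\<omega> \<in> space M. Q i \<omega> \<le> m} = measure (distr M (count_space UNIV) (Q i)) {..m}" for i
    by (subst measure_distr) (auto intro!: arg_cong[where f=prob])
  then show ?thesis by (metis steady_Q_distr)
qed

text \<open>Carries a finite mean from cycle \<open>k\<close> to cycle \<open>Suc k\<close>, as the
  cancellation of the queue terms in the mean drift requires.\<close>

lemma steady_Q_integrable:
  "integrable M (\<lambda>\<omega>. real (Q j \<omega>)) \<longleftrightarrow> integrable M (\<lambda>\<omega>. real (Q k \<omega>))"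
proof -
  have "integrable M (\<lambda>\<omega>. real (Q i \<omega>)) \<longleftrightarrow> integrable (distr M (count_space UNIV) (Q i)) real" for i
    by (subst integrable_distr_eq) auto
  then show ?thesis by (metis steady_Q_distr)
qed

lemma steady_Q_expectation:
  "expectation (\<lambda>\<omega>. real (Q j \<omega>)) = expectation (\<lambda>\<omega>. real (Q k \<omega>))"
proof -
  have "expectation (\<lambda>\<omega>. real (Q i \<omega>)) = integral\<^sup>L (distr M (count_space UNIV) (Q i)) real" for i
    by (subst integral_distr) auto
  then show ?thesis by (metis steady_Q_distr)
qed

text \<open>
  The integrand \<open>?U\<close> below is the unused budget of the cycle. Its mean is \<open>b - E[A]\<close> because the
  queue terms cancel, which needs \<open>E[Q]\<close> to be finite.
\<close>

lemma prob_empty_queue_le: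
  assumes "integrable M (\<lambda>\<omega>. real (Q k \<omega>))"
  shows "prob {\<omega> \<in> space M. Q k \<omega> \<le> 0} * (prob (no_query k) * prob (positive_budget k))
    \<le> b - expectation (\<lambda>\<omega>. real (A k \<omega>))"
proof -
  let ?F = "{\<omega> \<in> space M. Q k \<omega> \<le> 0} \<inter> no_query k \<inter> positive_budget k"
  let ?U = "\<lambda>\<omega>. real (Q (Suc k) \<omega>) - real (Q k \<omega>) - real (A k \<omega>) + real (budget k \<omega>)"
  have Q': "integrable M (\<lambda>\<omega>. real (Q (Suc k) \<omega>))"
    using assms steady_Q_integrable by blast
  have F: "?F \<in> events"
    unfolding no_query_def positive_budget_def by measurable
  \<comment> \<open>The recursion makes \<open>?U\<close> nonnegative everywhere. On
    \<open>?F\<close> the queue and the revenue vanish, so the whole budget, at least 1, is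
    lost.\<close>
  have U: "indicator ?F \<omega> \<le> ?U \<omega>" if "\<omega> \<in> space M" for \<omega>
    using overdraft[OF that, of k] no_query_A[of \<omega> k]
    by (auto simp: indicator_def positive_budget_def)
  have "prob ?F = expectation (indicator ?F)"
    using F by simp
  also have "\<dots> \<le> expectation ?U"
    using F Q' assms A_integrable budget_integrable U
    by (intro integral_mono) (auto intro!: integrable_real_indicator simp: less_top[symmetric])
  also have "\<dots> = b - expectation (\<lambda>\<omega>. real (A k \<omega>))"
    using Q' assms A_integrable budget_integrable steady_Q_expectation[of "Suc k" k]
    by (simp add: budget_mean)
  finally show ?thesis
    unfolding prob_starved_cycle[OF Q_le_in_past] .
qed

text \<open>A starved cycle adds nothing and removes at least one unit, so it leads from level at
  most \<open>Suc m\<close> to level at most \<open>m\<close>. Steady state then replaces the queue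
  of the next cycle by that of cycle \<open>k\<close>.\<close>

lemma prob_queue_le_Suc:
  "prob {\<omega> \<in> space M. Q k \<omega> \<le> Suc m} * (prob (no_query k) * prob (positive_budget k))
    \<le> prob {\<omega> \<in> space M. Q k \<omega> \<le> m}"
proof -
  have "prob ({\<omega> \<in> space M. Q k \<omega> \<le> Suc m} \<inter> no_query k \<inter> positive_budget k)
      \<le> prob {\<omega> \<in> space M. Q (Suc k) \<omega> \<le> m}"
  proof (rule finite_measure_mono)
    show "{\<omega> \<in> space M. Q k \<omega> \<le> Suc m} \<inter> no_query k \<inter> positive_budget k
        \<subseteq> {\<omega> \<in> space M. Q (Suc k) \<omega> \<le> m}"
    proof
      fix \<omega> assume "\<omega> \<in> {\<omega> \<in> space M. Q k \<omega> \<le> Suc m} \<inter> no_query k \<inter> positive_budget k"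
      then show "\<omega> \<in> {\<omega> \<in> space M. Q (Suc k) \<omega> \<le> m}"
        using overdraft[of \<omega> k] no_query_A[of \<omega> k] by (auto simp: positive_budget_def)
    qed
  qed measurable
  then show ?thesis
    unfolding prob_starved_cycle[OF Q_le_in_past] steady_Q_le[of "Suc k" _ k] .
qed

text \<open>Each of the \<open>m\<close> descents costs one factor, and the loss of budget at the
  empty queue costs another; hence the exponent \<open>Suc m\<close>.\<close>

lemma prob_queue_le:
  assumes "integrable M (\<lambda>\<omega>. real (Q k \<omega>))"
  shows "prob {\<omega> \<in> space M. Q k \<omega> \<le> m} * (prob (no_query k) * prob (positive_budget k)) ^ Suc m
    \<le> b - expectation (\<lambda>\<omega>. real (A k \<omega>))"
proof (induction m)
  case 0
  then show ?case using prob_empty_queue_le[OF assms] by simp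
next
  case (Suc m)
  let ?p = "prob (no_query k) * prob (positive_budget k)"
  have "prob {\<omega> \<in> space M. Q k \<omega> \<le> Suc m} * ?p ^ Suc (Suc m)
      = (prob {\<omega> \<in> space M. Q k \<omega> \<le> Suc m} * ?p) * ?p ^ Suc m"
    by simp
  also have "\<dots> \<le> prob {\<omega> \<in> space M. Q k \<omega> \<le> m} * ?p ^ Suc m"
    by (intro mult_right_mono prob_queue_le_Suc) simp
  also note Suc
  finally show ?case .
qed

section \<open>From the bounds on the levels to the mean of the queue\<close>

lemma mean_queue_bound:
  assumes int: "integrable M (\<lambda>\<omega>. real (Q k \<omega>))"
    and p: "p = prob (no_query k) * prob (positive_budget k)" "0 < p"
    and \<epsilon>: "0 < \<epsilon>" "b - \<epsilon> \<le> expectation (\<lambda>\<omega>. real (A k \<omega>))"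
  shows "ln (1 / \<epsilon>) \<le> 2 * (1 - ln p) * (expectation (\<lambda>\<omega>. real (Q k \<omega>)) + 1)"
proof -
  let ?q = "expectation (\<lambda>\<omega>. real (Q k \<omega>))"
  \<comment> \<open>Markov's inequality at \<open>Suc m\<close>, which exceeds twice the mean,
    leaves probability at least 1/2 for a queue of at most \<open>m\<close>. The threshold
    \<open>Suc m\<close> is positive even if the mean is 0.\<close>
  define m where "m = nat \<lfloor>2 * ?q\<rfloor>"
  have q: "0 \<le> ?q" by simp
  then have m: "real m \<le> 2 * ?q" "2 * ?q < real (Suc m)"
    unfolding m_def by linarith+
  have "prob {\<omega> \<in> space M. real (Suc m) \<le> real (Q k \<omega>)} \<le> ?q / real (Suc m)"
    by (rule integral_Markov_inequality_measure[OF int, of "{}"]) auto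
  also have "\<dots> \<le> 1 / 2"
    using m by (simp add: field_simps)
  finally have "1 / 2 \<le> 1 - prob {\<omega> \<in> space M. real (Suc m) \<le> real (Q k \<omega>)}"
    by simp
  also have "\<dots> = prob (space M - {\<omega> \<in> space M. real (Suc m) \<le> real (Q k \<omega>)})"
    by (rule prob_compl[symmetric]) measurable
  also have "space M - {\<omega> \<in> space M. real (Suc m) \<le> real (Q k \<omega>)} = {\<omega> \<in> space M. Q k \<omega> \<le> m}"
    by auto
  finally have "1 / 2 * p ^ Suc m \<le> prob {\<omega> \<in> space M. Q k \<omega> \<le> m} * p ^ Suc m"
    using p by (intro mult_right_mono) auto
  also have "\<dots> \<le> \<epsilon>"
    using prob_queue_le[OF int, of m] \<epsilon> p by simp
  finally have "ln (1 / 2 * p ^ Suc m) \<le> ln \<epsilon>"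
    using p \<epsilon> by (subst ln_le_cancel_iff) auto
  then have "ln (1 / \<epsilon>) \<le> ln 2 + real (Suc m) * (- ln p)"
    using p(2) \<epsilon>(1) by (simp add: ln_mult ln_div ln_realpow del: power_Suc of_nat_Suc)
  \<comment> \<open>The estimates \<open>ln 2 \<le> 2\<close> and
    \<open>Suc m \<le> 2 * (?q + 1)\<close> are generous on purpose: since \<open>?q\<close> is
    nonnegative, 2 is at most \<open>2 * (?q + 1)\<close>, and this common factor can be taken out
    next.\<close>
  also have "\<dots> \<le> 2 + 2 * (?q + 1) * (- ln p)"
  proof (intro add_mono mult_right_mono)
    have "p \<le> 1" using p by (simp add: mult_le_one)
    then show "0 \<le> - ln p" using p by simp
    show "ln 2 \<le> (2::real)" using ln_le_minus_one[of 2] by simp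
  qed (use m in simp)
  also have "\<dots> \<le> 2 * (1 - ln p) * (?q + 1)"
    using q by (simp add: algebra_simps)
  finally show ?thesis .
qed

end

end

theorem theorem2:
  fixes M :: "'w measure" and \<pi> :: "('s, 'u) algorithm"
    and \<nu> c b \<epsilon> \<phi> P_plus :: real and r N k :: nat
    and query click :: "nat \<Rightarrow> 'w \<Rightarrow> bool"
    and budget Q A :: "nat \<Rightarrow> 'w \<Rightarrow> nat"
    and seed :: "nat \<Rightarrow> 'w \<Rightarrow> 'u" and memory :: "nat \<Rightarrow> 'w \<Rightarrow> 's"
  assumes "ad_system M \<nu> c b r N \<pi> query click budget seed memory Q A"
    and "steady_state M Q A"
    and "\<epsilon> > 0"
    and "(\<integral>\<omega>. real (A k \<omega>) \<partial>M) \<ge> b - \<epsilon>"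
    and "\<phi> = measure M {\<omega> \<in> space M. \<forall>t \<in> {k * N..<k * N + N}. \<not> query t \<omega>}"
    and "P_plus = measure M {\<omega> \<in> space M. budget k \<omega> > 0}"
    and "\<phi> > 0" and "P_plus > 0"
  shows "enn2ereal (\<integral>\<^sup>+\<omega>. of_nat (Q k \<omega>) \<partial>M)
           \<ge> ereal (ln (1 / \<epsilon>) / (2 * (1 - ln (\<phi> * P_plus))) - 1)"
proof -
  interpret ad_system M \<nu> c b r N \<pi> query click budget seed memory Q A by fact
  let ?n = "\<integral>\<^sup>+\<omega>. of_nat (Q k \<omega>) \<partial>M"
  show ?thesis
  \<comment> \<open>An infinite mean satisfies any real lower bound. Finiteness of the integral
    supplies the integrability that the drift argument needs.\<close>
  proof (cases "?n = \<infinity>")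
    case False
    then have int: "integrable M (\<lambda>\<omega>. real (Q k \<omega>))"
      by (intro integrableI_nonneg) (auto simp: ennreal_of_nat_eq_real_of_nat less_top)
    then have n: "?n = ennreal (expectation (\<lambda>\<omega>. real (Q k \<omega>)))"
      using nn_integral_eq_integral[OF int] by (simp add: ennreal_of_nat_eq_real_of_nat)
    have p: "\<phi> * P_plus = prob (no_query k) * prob (positive_budget k)"
      using assms by (simp add: no_query_def positive_budget_def)
    then have "\<phi> * P_plus \<le> 1"
      by (simp add: mult_le_one)
    \<comment> \<open>From \<open>ln x \<le> x - 1\<close> and \<open>x \<le> 1\<close> the
      logarithm is at most 0, so dividing by this factor keeps the direction of the
      inequality.\<close>
    then have "0 < 1 - ln (\<phi> * P_plus)"
      using ln_le_minus_one[OF mult_pos_pos[OF \<open>\<phi> > 0\<close> \<open>P_plus > 0\<close>]] by linarith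
    moreover have "ln (1 / \<epsilon>) \<le> 2 * (1 - ln (\<phi> * P_plus)) * (expectation (\<lambda>\<omega>. real (Q k \<omega>)) + 1)"
      by (rule mean_queue_bound[OF _ int p]) (use assms in auto)
    ultimately have "ln (1 / \<epsilon>) / (2 * (1 - ln (\<phi> * P_plus))) - 1 \<le> expectation (\<lambda>\<omega>. real (Q k \<omega>))"
      by (simp add: pos_divide_le_eq algebra_simps)
    then show ?thesis
      by (simp add: n enn2ereal_ennreal)
  qed simp
qed

end
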